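(* For any $p\in[0,1]$ and any $n\ge1$, in a row of $n$ seats with a single entrance filled by $p$-courteous theatregoers choosing seats according to the right-biased geometric distribution (model described in the context), the expected number of occupied seats when the process ends is at least $\frac{n+1}{2}$. Moreover, this bound is attained (with equality) for $p=0$.
   Context: Row model: a row of $n$ seats with a single entrance at one end. Theatregoers arrive one at a time; each is, independently, courteous with probability $p$ and selfish with probability $1-p$, and this status never changes. A seated selfish theatregoer never gets up, so no later theatregoer can walk past her seat; a seated courteous theatregoer never blocks. An empty seat is accessible if it can be reached from the entrance without passing a seat occupied by a selfish theatregoer. When there are $m\ge1$ accessible empty seats, labelled $1,\dots,m$ in increasing order of distance from the entrance, the arriving theatregoer sits in the $j$-th one with probability $2^{-(m+1-j)}$ for $j=2,\dots,m$ and with probability $2^{-(m-1)}$ for $j=1$ (right-biased geometric distribution). The process ends when no accessible empty seat remains. *)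

theory Defs
  imports "HOL-Probability.Probability"
begin

definition right_biased_mass :: "nat \<Rightarrow> nat \<Rightarrow> real" where
  "right_biased_mass m j =
     (if j = 1 then 1 / 2 ^ (m - 1)
      else if 2 \<le> j \<and> j \<le> m then 1 / 2 ^ (m + 1 - j)
      else 0)"

text \<open>For \<open>m = 0\<close> the value below is irrelevant: it is used only when some accessible
  empty seat exists.\<close>

definition right_biased_pmf :: "nat \<Rightarrow> nat pmf" where
  "right_biased_pmf m = embed_pmf (right_biased_mass m)"

lemma right_biased_mass_nonneg: "right_biased_mass m j \<ge> 0"
  by (simp add: right_biased_mass_def)

lemma sum_right_biased_mass:
  assumes "m \<ge> 1"
  shows "(\<Sum>j\<in>{1..m}. right_biased_mass m j) = 1"
  using assms
proof (induction m rule: dec_induct)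
  case base
  show ?case by (simp add: right_biased_mass_def)
next
  case (step m)
  have half: "right_biased_mass (Suc m) j = right_biased_mass m j / 2" if "j \<in> {1..m}" for j
    using that step.hyps by (cases m) (auto simp: right_biased_mass_def Suc_diff_le)
  have last: "right_biased_mass (Suc m) (Suc m) = 1 / 2"
    using step.hyps by (simp add: right_biased_mass_def)
  have "(\<Sum>j\<in>{1..Suc m}. right_biased_mass (Suc m) j)
      = (\<Sum>j\<in>{1..m}. right_biased_mass m j / 2) + 1 / 2"
    using last sum.cong[OF refl half, of "{1..m}" "\<lambda>j. j"] by simp
  then show ?case
    using step.IH by (simp flip: sum_divide_distrib)
qed

lemma nn_integral_right_biased_mass:
  assumes "m \<ge> 1"
  shows "(\<integral>\<^sup>+ j. ennreal (right_biased_mass m j) \<partial>count_space UNIV) = 1"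
proof -
  have "(\<integral>\<^sup>+ j. ennreal (right_biased_mass m j) \<partial>count_space UNIV)
      = (\<Sum>j\<in>{1..m}. ennreal (right_biased_mass m j))"
    using assms by (intro nn_integral_count_space') (auto simp: right_biased_mass_def)
  also have "\<dots> = ennreal (\<Sum>j\<in>{1..m}. right_biased_mass m j)"
    by (simp add: right_biased_mass_nonneg sum_ennreal)
  finally show ?thesis
    using sum_right_biased_mass[OF assms] by simp
qed

lemma pmf_right_biased_pmf:
  assumes "m \<ge> 1"
  shows "pmf (right_biased_pmf m) j = right_biased_mass m j"
  unfolding right_biased_pmf_def
  by (rule pmf_embed_pmf[OF right_biased_mass_nonneg nn_integral_right_biased_mass[OF assms]])

lemma set_right_biased_pmf:
  assumes "m \<ge> 1"
  shows "set_pmf (right_biased_pmf m) = {1..m}"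
  using assms by (auto simp: set_pmf_eq pmf_right_biased_pmf right_biased_mass_def)

datatype seat = Empty | Courteous | Selfish

text \<open>A row is the list of its seats in increasing order of distance from the entrance;
  seats are referred to by their position in that list, starting with 0.\<close>

type_synonym row = "seat list"

definition accessible :: "row \<Rightarrow> nat \<Rightarrow> bool" where
  "accessible r i \<longleftrightarrow> i < length r \<and> r ! i = Empty \<and> (\<forall>k<i. r ! k \<noteq> Selfish)"

definition accessible_seats :: "row \<Rightarrow> nat list" where
  "accessible_seats r = filter (accessible r) [0..<length r]"

definition arrival :: "real \<Rightarrow> row \<Rightarrow> row pmf" where
  "arrival p r = do {
     courteous \<leftarrow> bernoulli_pmf p;
     j \<leftarrow> right_biased_pmf (length (accessible_seats r));
     return_pmf (r[accessible_seats r ! (j - 1) := (if courteous then Courteous else Selfish)])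
   }"

definition occupied_seats :: "row \<Rightarrow> nat" where
  "occupied_seats r = card {i. i < length r \<and> r ! i \<noteq> Empty}"

lemma arrival_occupies_seat:
  assumes "accessible_seats r \<noteq> []" "r' \<in> set_pmf (arrival p r)"
  obtains i x where "accessible r i" "x \<noteq> Empty" "r' = r[i := x]"
proof -
  have len: "length (accessible_seats r) \<ge> 1"
    using assms(1) by (cases "accessible_seats r") auto
  from assms(2) obtain j b where
    j: "j \<in> set_pmf (right_biased_pmf (length (accessible_seats r)))" and
    r': "r' = r[accessible_seats r ! (j - 1) := (if b then Courteous else Selfish)]"
    by (auto simp: arrival_def)
  from j have "j - 1 < length (accessible_seats r)"
    unfolding set_right_biased_pmf[OF len] by auto
  then have "accessible_seats r ! (j - 1) \<in> set (accessible_seats r)"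
    by (rule nth_mem)
  then have "accessible r (accessible_seats r ! (j - 1))"
    by (simp add: accessible_seats_def)
  then show thesis
    using that r' by (metis seat.distinct(1) seat.distinct(3))
qed

lemma arrival_decreases:
  assumes "accessible_seats r \<noteq> []" "r' \<in> set_pmf (arrival p r)"
  shows "length r' - occupied_seats r' < length r - occupied_seats r"
proof -
  from assms obtain i x where ix: "accessible r i" "x \<noteq> Empty" "r' = r[i := x]"
    by (rule arrival_occupies_seat)
  have i: "i < length r" "r ! i = Empty"
    using ix(1) by (auto simp: accessible_def)
  have "{k. k < length r' \<and> r' ! k \<noteq> Empty} = insert i {k. k < length r \<and> r ! k \<noteq> Empty}"
    using ix i by (auto simp: nth_list_update)
  then have occ: "occupied_seats r' = Suc (occupied_seats r)"
    using i by (simp add: occupied_seats_def)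
  have "occupied_seats r' \<le> card {..<length r'}"
    unfolding occupied_seats_def by (rule card_mono) auto
  then show ?thesis
    using occ ix(3) by simp
qed

text \<open>Distribution of the row when the process, started in a given row, has ended.\<close>

function final_row :: "real \<Rightarrow> row \<Rightarrow> row pmf" where
  "final_row p r =
     (if accessible_seats r = [] then return_pmf r
      else arrival p r \<bind> final_row p)"
  by pat_completeness auto
termination
  by (relation "Wellfounded.measure (\<lambda>(p, r). length r - occupied_seats r)")
     (auto intro: arrival_decreases)

declare final_row.simps [simp del]

definition expected_occupied :: "real \<Rightarrow> nat \<Rightarrow> real" where
  "expected_occupied p n =
     measure_pmf.expectation (final_row p (replicate n Empty)) (\<lambda>r. real (occupied_seats r))"

end

theory Submission
  imports Defs
begin

text \<open>The future of the process depends only on the number \<open>m\<close> of accessible empty seats: a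
  courteous arrival lowers it to \<open>m - 1\<close>, a selfish one in the \<open>j\<close>-th accessible seat to
  \<open>j - 1\<close>. This gives a recurrence for the expected number of future arrivals. The right-biased
  weights are such that \<open>\<ell> m = (m + 1) / 2\<close> (and \<open>\<ell> 0 = 0\<close>) averages to \<open>\<ell> m - 1\<close> after
  a selfish arrival, so \<open>\<ell>\<close> solves the recurrence for \<open>p = 0\<close>; as \<open>\<ell> (m - 1) \<ge> \<ell> m - 1\<close>,
  it is a subsolution for every \<open>p\<close>.\<close>

lemma finite_set_pmf_arrival:
  assumes "accessible_seats r \<noteq> []"
  shows "finite (set_pmf (arrival p r))"
proof -
  have "length (accessible_seats r) \<ge> 1"
    using assms by (cases "accessible_seats r") auto
  then show ?thesis
    by (simp add: arrival_def set_right_biased_pmf)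
qed

text \<open>Finite supports let \<open>pmf_expectation_bind\<close> expand the expectation of a bind
  as a finite sum.\<close>

lemma finite_set_pmf_final_row: "finite (set_pmf (final_row p r))"
proof (induction p r rule: final_row.induct)
  case (1 p r)
  then show ?case
    using finite_set_pmf_arrival[of r p] by (subst final_row.simps) auto
qed

section \<open>Effect of one arrival on the accessible seats\<close>

lemma sorted_wrt_less_accessible_seats: "sorted_wrt (<) (accessible_seats r)"
  by (simp add: accessible_seats_def sorted_wrt_filter)

lemma filter_less_nth_eq_take:
  fixes xs :: "'a :: linorder list"
  assumes "sorted_wrt (<) xs" "k < length xs"
  shows "filter (\<lambda>x. x < xs ! k) xs = take k xs"
proof -
  have "filter (\<lambda>x. x < xs ! k) (take k xs) = take k xs"
    using assms by (auto simp: filter_id_conv in_set_conv_nth sorted_wrt_nth_less)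
  moreover have "filter (\<lambda>x. x < xs ! k) (drop k xs) = []"
  proof -
    have "xs ! k \<le> xs ! (k + i)" if "k + i < length xs" for i
      using assms that sorted_wrt_nth_less[of "(<)" xs k "k + i"] by (cases "i = 0") auto
    then show ?thesis
      by (auto simp: filter_empty_conv in_set_conv_nth not_less)
  qed
  ultimately show ?thesis
    using filter_append[of "\<lambda>x. x < xs ! k" "take k xs" "drop k xs"] by simp
qed

lemma accessible_seats_nth:
  assumes "k < length (accessible_seats r)"
  shows "accessible r (accessible_seats r ! k)"
  using nth_mem[OF assms] by (simp add: accessible_seats_def)

text \<open>A selfish theatregoer cuts off exactly the accessible seats beyond her own. The list is
  increasing, so its first \<open>k\<close> entries remain; \<open>k\<close> counts from 0 and is
  the model's label minus one.\<close>

lemma length_accessible_seats_selfish: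
  assumes "k < length (accessible_seats r)"
  shows "length (accessible_seats (r[accessible_seats r ! k := Selfish])) = k"
proof -
  define i where "i = accessible_seats r ! k"
  have i: "accessible r i"
    unfolding i_def using assms by (rule accessible_seats_nth)
  have "accessible (r[i := Selfish]) = (\<lambda>x. accessible r x \<and> x < i)"
    using i by (auto simp: fun_eq_iff accessible_def nth_list_update split: if_splits)
  then have "accessible_seats (r[i := Selfish]) = filter (\<lambda>x. x < i) (accessible_seats r)"
    by (simp add: accessible_seats_def)
  also have "\<dots> = take k (accessible_seats r)"
    unfolding i_def by (rule filter_less_nth_eq_take[OF sorted_wrt_less_accessible_seats assms])
  finally show ?thesis
    using assms by (simp add: i_def)
qed

lemma length_accessible_seats_courteous:
  assumes "k < length (accessible_seats r)"
  shows "length (accessible_seats (r[accessible_seats r ! k := Courteous])) =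
    length (accessible_seats r) - 1"
proof -
  define i where "i = accessible_seats r ! k"
  have i: "accessible r i"
    unfolding i_def using assms by (rule accessible_seats_nth)
  \<comment> \<open>The seat was \<open>Empty\<close> and becomes \<open>Courteous\<close>; neither
    blocks, so the only accessible seat lost is the one taken.\<close>
  have "r[i := Courteous] ! k = Selfish \<longleftrightarrow> r ! k = Selfish" for k
    using i by (auto simp: accessible_def nth_list_update)
  then have "accessible (r[i := Courteous]) = (\<lambda>x. accessible r x \<and> i \<noteq> x)"
    using i by (auto simp: fun_eq_iff accessible_def nth_list_update)
  then have "accessible_seats (r[i := Courteous]) = filter (\<lambda>x. i \<noteq> x) (accessible_seats r)"
    by (simp add: accessible_seats_def)
  also have "\<dots> = remove1 i (accessible_seats r)"
    by (simp add: accessible_seats_def distinct_remove1_removeAll removeAll_filter_not_eq)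
  finally show ?thesis
    using assms by (simp add: i_def length_remove1)
qed

lemma occupied_seats_update:
  assumes "accessible r i" "x \<noteq> Empty"
  shows "occupied_seats (r[i := x]) = Suc (occupied_seats r)"
proof -
  have i: "i < length r" "r ! i = Empty"
    using assms by (auto simp: accessible_def)
  then have "{k. k < length (r[i := x]) \<and> r[i := x] ! k \<noteq> Empty}
      = insert i {k. k < length r \<and> r ! k \<noteq> Empty}"
    using assms by (auto simp: nth_list_update)
  then show ?thesis
    using i by (simp add: occupied_seats_def)
qed

section \<open>First-step recurrence for the expected number of arrivals\<close>

text \<open>The index \<open>k\<close> counts the accessible seats before the chosen one, whose
  label is \<open>Suc k\<close>; these are the seats left after a selfish arrival. The leading 1 is
  the current arrival.\<close>

fun expected_arrivals :: "real \<Rightarrow> nat \<Rightarrow> real" where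
  "expected_arrivals p 0 = 0"
| "expected_arrivals p (Suc m) = 1 + p * expected_arrivals p m
     + (1 - p) * (\<Sum>k\<in>{..m}. right_biased_mass (Suc m) (Suc k) * expected_arrivals p k)"

text \<open>Conditioning on the first arrival: \<open>seat k x\<close> is the conditional
  expectation given status \<open>x\<close> and the seat labelled \<open>Suc k\<close>. Status and
  seat are independent, so their probabilities multiply.\<close>

lemma expectation_final_row_step:
  fixes h :: "row \<Rightarrow> real"
  assumes p: "p \<in> {0..1}" and m: "length (accessible_seats r) = Suc m"
  defines "seat k x \<equiv> measure_pmf.expectation (final_row p (r[accessible_seats r ! k := x])) h"
  shows "measure_pmf.expectation (final_row p r) h =
    (\<Sum>k\<in>{..m}. right_biased_mass (Suc m) (Suc k)
       * (p * seat k Courteous + (1 - p) * seat k Selfish))"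
proof -
  define status where "status b = (if b then Courteous else Selfish)" for b
  have fin: "finite (set_pmf (right_biased_pmf (Suc m)))"
    by (simp add: set_right_biased_pmf)
  have ne: "accessible_seats r \<noteq> []"
    using m by auto
  have inner: "measure_pmf.expectation (right_biased_pmf (Suc m) \<bind>
        (\<lambda>j. final_row p (r[accessible_seats r ! (j - 1) := x]))) h
      = (\<Sum>k\<in>{..m}. right_biased_mass (Suc m) (Suc k) * seat k x)" for x
  proof -
    have "measure_pmf.expectation (right_biased_pmf (Suc m) \<bind>
        (\<lambda>j. final_row p (r[accessible_seats r ! (j - 1) := x]))) h
      = (\<Sum>j\<in>{1..Suc m}. right_biased_mass (Suc m) j * seat (j - 1) x)"
      by (subst pmf_expectation_bind[where A = "{1..Suc m}"])
        (auto simp: set_right_biased_pmf finite_set_pmf_final_row pmf_right_biased_pmf seat_def)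
    also have "\<dots> = (\<Sum>k\<in>{..m}. right_biased_mass (Suc m) (Suc k) * seat k x)"
      by (rule sum.reindex_bij_witness[of _ Suc "\<lambda>j. j - 1"]) auto
    finally show ?thesis .
  qed
  have "final_row p r = bernoulli_pmf p \<bind> (\<lambda>b. right_biased_pmf (Suc m) \<bind>
      (\<lambda>j. final_row p (r[accessible_seats r ! (j - 1) := status b])))"
    using ne by (subst final_row.simps)
      (simp add: arrival_def m status_def bind_assoc_pmf bind_return_pmf)
  then have "measure_pmf.expectation (final_row p r) h
      = (\<Sum>b\<in>UNIV. pmf (bernoulli_pmf p) b
           * (\<Sum>k\<in>{..m}. right_biased_mass (Suc m) (Suc k) * seat k (status b)))"
    using fin by (simp only:, subst pmf_expectation_bind[where A = UNIV])
      (simp_all add: inner finite_set_pmf_final_row del: One_nat_def)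
  also have "\<dots> = p * (\<Sum>k\<in>{..m}. right_biased_mass (Suc m) (Suc k) * seat k Courteous)
      + (1 - p) * (\<Sum>k\<in>{..m}. right_biased_mass (Suc m) (Suc k) * seat k Selfish)"
    using p by (simp add: UNIV_bool status_def)
  finally show ?thesis
    by (simp add: sum_distrib_left distrib_left mult.left_commute flip: sum.distrib)
qed

lemma sum_right_biased_mass_Suc: "(\<Sum>k\<in>{..m}. right_biased_mass (Suc m) (Suc k)) = 1"
proof -
  have "(\<Sum>k\<in>{..m}. right_biased_mass (Suc m) (Suc k))
      = (\<Sum>j\<in>{1..Suc m}. right_biased_mass (Suc m) j)"
    by (rule sum.reindex_bij_witness[of _ "\<lambda>j. j - 1" Suc]) auto
  then show ?thesis
    using sum_right_biased_mass[of "Suc m"] by simp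
qed

text \<open>The row stays arbitrary in the induction because each arrival changes it. An arrival
  adds one occupied seat, and the number of accessible seats left is all that the induction
  hypothesis needs.\<close>

lemma expectation_final_row:
  assumes p: "p \<in> {0..1}"
  shows "measure_pmf.expectation (final_row p r) (\<lambda>r. real (occupied_seats r)) =
    real (occupied_seats r) + expected_arrivals p (length (accessible_seats r))"
proof (induction "length (accessible_seats r)" arbitrary: r rule: less_induct)
  case less
  show ?case
  proof (cases "length (accessible_seats r)")
    case 0
    then show ?thesis
      by (subst final_row.simps) simp
  next
    case (Suc m)
    define w where "w k = right_biased_mass (Suc m) (Suc k)" for k
    define a where "a = expected_arrivals p"
    \<comment> \<open>\<open>c\<close> gathers what does not depend on the chosen seat; as the
      weights sum to 1, it leaves the average unchanged.\<close>
    define c where "c = real (occupied_seats r) + 1 + p * a m"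
    have IH: "measure_pmf.expectation (final_row p (r[accessible_seats r ! k := Courteous]))
          (\<lambda>r. real (occupied_seats r)) = real (occupied_seats r) + 1 + a m"
        "measure_pmf.expectation (final_row p (r[accessible_seats r ! k := Selfish]))
          (\<lambda>r. real (occupied_seats r)) = real (occupied_seats r) + 1 + a k"
      if "k \<le> m" for k
    proof -
      have k: "k < length (accessible_seats r)"
        using that Suc by simp
      show "measure_pmf.expectation (final_row p (r[accessible_seats r ! k := Courteous]))
          (\<lambda>r. real (occupied_seats r)) = real (occupied_seats r) + 1 + a m"
        by (subst less) (simp_all add: length_accessible_seats_courteous[OF k] Suc a_def
            occupied_seats_update[OF accessible_seats_nth[OF k]])
      show "measure_pmf.expectation (final_row p (r[accessible_seats r ! k := Selfish]))
          (\<lambda>r. real (occupied_seats r)) = real (occupied_seats r) + 1 + a k"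
        using k by (subst less) (simp_all add: length_accessible_seats_selfish[OF k] a_def
            occupied_seats_update[OF accessible_seats_nth[OF k]])
    qed
    have "measure_pmf.expectation (final_row p r) (\<lambda>r. real (occupied_seats r))
        = (\<Sum>k\<in>{..m}. w k * c + (1 - p) * (w k * a k))"
      unfolding expectation_final_row_step[OF p Suc]
      by (rule sum.cong) (simp_all add: IH w_def c_def algebra_simps)
    also have "\<dots> = c + (1 - p) * (\<Sum>k\<in>{..m}. w k * a k)"
      using sum_right_biased_mass_Suc[of m]
      by (simp add: sum.distrib w_def flip: sum_distrib_left sum_distrib_right)
    finally show ?thesis
      by (simp add: Suc w_def a_def c_def)
  qed
qed

section \<open>Comparison of the recurrence with (m + 1) / 2\<close>

text \<open>This is \<ell> from the overview. At 0 nobody can sit any more, whereas the formula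
  would give 1/2.\<close>

definition arrivals_bound :: "nat \<Rightarrow> real" where
  "arrivals_bound m = (if m = 0 then 0 else (real m + 1) / 2)"

text \<open>A new farthest seat takes probability 1/2 and keeps the proportions among the nearer
  seats.\<close>

lemma right_biased_mass_Suc:
  assumes "k \<le> m"
  shows "right_biased_mass (Suc (Suc m)) (Suc k) = right_biased_mass (Suc m) (Suc k) / 2"
  using assms by (auto simp: right_biased_mass_def Suc_diff_le)

text \<open>If S is the sum for \<open>m\<close>, halving the old weights makes the next sum S / 2 +
  \<open>arrivals_bound (Suc m)\<close> / 2. By induction this is
  \<open>arrivals_bound (Suc m)\<close> - 1/2, and \<open>arrivals_bound\<close> grows by 1/2 at
  each step from \<open>Suc m\<close> on.\<close>

lemma sum_right_biased_mass_arrivals_bound: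
  "(\<Sum>k\<in>{..m}. right_biased_mass (Suc m) (Suc k) * arrivals_bound k) = arrivals_bound (Suc m) - 1"
proof (induction m)
  case 0
  show ?case by (simp add: arrivals_bound_def)
next
  case (Suc m)
  have "(\<Sum>k\<in>{..m}. right_biased_mass (Suc (Suc m)) (Suc k) * arrivals_bound k)
      = (\<Sum>k\<in>{..m}. right_biased_mass (Suc m) (Suc k) * arrivals_bound k) / 2"
    by (simp add: right_biased_mass_Suc sum_divide_distrib)
  moreover have "right_biased_mass (Suc (Suc m)) (Suc (Suc m)) = 1 / 2"
    by (simp add: right_biased_mass_def)
  ultimately show ?case
    using Suc.IH by (simp add: arrivals_bound_def[of "Suc _"] field_simps)
qed

text \<open>Strong induction, since a selfish arrival may leave any smaller number of seats. Both
  branches contribute at least \<open>arrivals_bound m - 1\<close>, and the weights \<open>p\<close>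
  and \<open>1 - p\<close> are nonnegative with sum 1.\<close>

lemma expected_arrivals_ge:
  assumes p: "p \<in> {0..1}"
  shows "arrivals_bound m \<le> expected_arrivals p m"
proof (induction m rule: less_induct)
  case (less m)
  show ?case
  proof (cases m)
    case 0
    then show ?thesis by (simp add: arrivals_bound_def)
  next
    case (Suc l)
    let ?S = "\<Sum>k\<in>{..l}. right_biased_mass (Suc l) (Suc k) * expected_arrivals p k"
    have "(\<Sum>k\<in>{..l}. right_biased_mass (Suc l) (Suc k) * arrivals_bound k) \<le> ?S"
      using less Suc by (intro sum_mono mult_left_mono right_biased_mass_nonneg) auto
    then have "(1 - p) * (arrivals_bound m - 1) \<le> (1 - p) * ?S"
      using p Suc by (intro mult_left_mono) (auto simp: sum_right_biased_mass_arrivals_bound)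
    \<comment> \<open>The increment is 1/2, except from 0 to 1, where it is exactly 1.\<close>
    moreover have "arrivals_bound m - 1 \<le> arrivals_bound l"
      using Suc by (simp add: arrivals_bound_def)
    then have "arrivals_bound m - 1 \<le> expected_arrivals p l"
      using less[of l] Suc by simp
    then have "p * (arrivals_bound m - 1) \<le> p * expected_arrivals p l"
      using p by (intro mult_left_mono) auto
    ultimately show ?thesis
      using Suc by (simp add: algebra_simps)
  qed
qed

text \<open>At \<open>p = 0\<close> the courteous term vanishes and the recurrence becomes the
  averaging identity for \<open>arrivals_bound\<close>.\<close>

lemma expected_arrivals_selfish: "expected_arrivals 0 m = arrivals_bound m"
proof (induction m rule: less_induct)
  case (less m)
  then show ?case
    using sum_right_biased_mass_arrivals_bound
    by (cases m) (simp_all add: arrivals_bound_def[of 0])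
qed

text \<open>At the start all \<open>n\<close> seats are accessible and none is occupied, so every
  seat occupied at the end comes from an arrival.\<close>

lemma expected_occupied_eq:
  assumes "p \<in> {0..1}"
  shows "expected_occupied p n = expected_arrivals p n"
proof -
  have "accessible_seats (replicate n Empty) = [0..<n]"
    by (auto simp: accessible_seats_def accessible_def filter_id_conv)
  moreover have "{i. i < n \<and> replicate n Empty ! i \<noteq> Empty} = {}"
    by auto
  then have "occupied_seats (replicate n Empty) = 0"
    by (simp add: occupied_seats_def)
  ultimately show ?thesis
    using expectation_final_row[OF assms, of "replicate n Empty"]
    by (simp add: expected_occupied_def)
qed

theorem theorem6:
  fixes n :: nat
  assumes "n \<ge> 1"
  shows "(\<forall>p\<in>{0..1::real}. expected_occupied p n \<ge> (real n + 1) / 2)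
    \<and> expected_occupied 0 n = (real n + 1) / 2"
proof -
  have "arrivals_bound n = (real n + 1) / 2"
    using assms by (simp add: arrivals_bound_def)
  then show ?thesis
    using expected_arrivals_ge[of _ n]
    by (metis atLeastAtMost_iff expected_arrivals_selfish expected_occupied_eq order_refl zero_le_one)
qed

end
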